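(* Let $B\subseteq\mathbb S_O$ be a finite premise base with effectively decidable membership. Assume that the predecessor operator $P_O$ is finite-valued and computable, that predecessor unfolding along $P_O$ is well-founded, and that $P_O$ is aligned with one-step inference relative to $B$ (all as defined in the context). Then for every $s\in\mathbb S_O$, the derivation depth $\mathrm{Dd}(s\mid B)$ is a unique, finite, and computable (from $\mathrm{enc}_O(s)$) non-negative integer.
   Context: $\mathcal L$ is many-sorted first-order logic with least fixed-point operators FO(LFP), interpreted over finite structures with a discrete bounded time domain. $\mathcal P$ is a fixed effective proof system for $\mathcal L$ with decidable proof checking. $\mathbb S_O$ is a fixed ambient set of semantic states (formulas of $\mathcal L$) with finite binary encodings $\mathrm{enc}_O(s)\in\{0,1\}^*$, such that equality of encoded states is decidable and all relevant predicates are effectively evaluable from the encodings. Predecessor operator: $P_O$ assigns to each $s\in\mathbb S_O$ a set $P_O(s)\subseteq\mathbb S_O$. Finite and computable predecessors: for every $s$, $P_O(s)$ is finite and effectively computable from $\mathrm{enc}_O(s)$. Well-foundedness: for every $s$, the backward unfolding of $s$ along $P_O$ (repeatedly passing from a state to an element of its predecessor set) contains no infinite chain. Alignment relative to $B$: for every $s\in\mathbb S_O\setminus B$, $P_O(s)$ is exactly the set of immediate premises in a fixed normal-form single-step inference of $\mathcal P$ concluding $s$; elements of $B$ are available premises and need not be inferred. Derivation depth: $\mathrm{Dd}(s\mid B)=0$ if $s\in B$, and otherwise $\mathrm{Dd}(s\mid B)=1+\max_{s'\in P_O(s)}\mathrm{Dd}(s'\mid B)$, with the convention that the maximum over the empty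 set is $0$. *)

theory Defs
  imports Complex_Main "HOL-Library.Nat_Bijection" "HOL-Library.Extended_Nat"
begin

section \<open>Computability\<close>

text \<open>Partial recursive functions. An application to an argument list of the wrong length need
  not be undefined; this does not affect the class of functions that are computed.\<close>

datatype recf =
    Zero
  | Succ
  | Proj nat
  | Comp recf "recf list"
  | PrimRec recf recf
  | Mu recf

fun eval :: "recf \<Rightarrow> nat list \<Rightarrow> nat option" where
  "eval Zero xs = Some 0"
| "eval Succ xs = (case xs of [] \<Rightarrow> None | x # _ \<Rightarrow> Some (Suc x))"
| "eval (Proj i) xs = (if i < length xs then Some (xs ! i) else None)"
| "eval (Comp f gs) xs = Option.bind (those (map (\<lambda>g. eval g xs) gs)) (eval f)"
| "eval (PrimRec f g) xs = (case xs of [] \<Rightarrow> None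
     | n # ys \<Rightarrow> rec_nat (eval f ys) (\<lambda>k v. Option.bind v (\<lambda>v. eval g (k # v # ys))) n)"
| "eval (Mu f) xs =
     (if \<exists>n. eval f (n # xs) = Some 0 \<and> (\<forall>m<n. \<exists>v. eval f (m # xs) = Some (Suc v))
      then Some (LEAST n. eval f (n # xs) = Some 0) else None)"

text \<open>\<open>e x\<close> is the numerical code of the object \<open>x\<close>. The machine has to halt with the right answer
  on the codes of elements of \<open>A\<close>; nothing is required on other inputs.\<close>

definition computable_on :: "'a set \<Rightarrow> ('a \<Rightarrow> nat) \<Rightarrow> ('a \<Rightarrow> nat) \<Rightarrow> bool" where
  "computable_on A e f \<longleftrightarrow> (\<exists>r. \<forall>x\<in>A. eval r [e x] = Some (f x))"

definition decidable_on :: "'a set \<Rightarrow> ('a \<Rightarrow> nat) \<Rightarrow> ('a \<Rightarrow> bool) \<Rightarrow> bool" where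
  "decidable_on A e Q \<longleftrightarrow> computable_on A e (\<lambda>x. of_bool (Q x))"

text \<open>Binary value of a string; the added leading 1 makes the numbering injective.\<close>

definition string_code :: "bool list \<Rightarrow> nat" where
  "string_code bs = horner_sum of_bool 2 (bs @ [True])"


section \<open>Many-sorted first-order logic with least fixed points\<close>

text \<open>Sorts and symbols are natural numbers. The signature has a sort of time points and a
  binary symbol for their order.\<close>

record signature =
  sorts :: "nat set"
  fun_type :: "nat \<Rightarrow> (nat list \<times> nat) option"
  rel_type :: "nat \<Rightarrow> nat list option"
  time_sort :: nat
  time_le :: nat

definition signature_wf :: "signature \<Rightarrow> bool" where
  "signature_wf \<L> \<longleftrightarrow>
     (\<forall>f ss s. fun_type \<L> f = Some (ss, s) \<longrightarrow> set ss \<subseteq> sorts \<L> \<and> s \<in> sorts \<L>) \<and>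
     (\<forall>R ss. rel_type \<L> R = Some ss \<longrightarrow> set ss \<subseteq> sorts \<L>) \<and>
     time_sort \<L> \<in> sorts \<L> \<and>
     rel_type \<L> (time_le \<L>) = Some [time_sort \<L>, time_sort \<L>]"

text \<open>A first-order variable is a pair of its sort and a name, a relation variable a pair of a
  name and the list of its argument sorts.\<close>

type_synonym var = "nat \<times> nat"
type_synonym rvar = "nat \<times> nat list"

datatype tm = Var var | App nat "tm list"

text \<open>\<open>Lfp X vs \<phi> ts\<close> is \<open>[lfp\<^bsub>X,vs\<^esub> \<phi>](ts)\<close>, where \<open>X\<close> has the argument sorts of \<open>vs\<close>.\<close>

datatype fm =
    Eq tm tm
  | Rel nat "tm list"
  | RVar rvar "tm list"
  | Neg fm
  | Conj fm fm
  | Disj fm fm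
  | Impl fm fm
  | Forall var fm
  | Exists var fm
  | Lfp nat "var list" fm "tm list"

abbreviation lfp_rvar :: "nat \<Rightarrow> var list \<Rightarrow> rvar" where
  "lfp_rvar X vs \<equiv> (X, map fst vs)"

fun has_sort :: "signature \<Rightarrow> tm \<Rightarrow> nat \<Rightarrow> bool" where
  "has_sort \<L> (Var v) s \<longleftrightarrow> fst v = s \<and> s \<in> sorts \<L>"
| "has_sort \<L> (App f ts) s \<longleftrightarrow>
     (\<exists>ss. fun_type \<L> f = Some (ss, s) \<and> list_all2 (has_sort \<L>) ts ss)"

text \<open>\<open>polar X True \<phi>\<close>: all free occurrences of \<open>X\<close> in \<open>\<phi>\<close> are positive;
  \<open>polar X False \<phi>\<close>: all of them are negative.\<close>

fun polar :: "rvar \<Rightarrow> bool \<Rightarrow> fm \<Rightarrow> bool" where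
  "polar X b (Eq t u) \<longleftrightarrow> True"
| "polar X b (Rel R ts) \<longleftrightarrow> True"
| "polar X b (RVar Y ts) \<longleftrightarrow> (Y = X \<longrightarrow> b)"
| "polar X b (Neg \<phi>) \<longleftrightarrow> polar X (\<not> b) \<phi>"
| "polar X b (Conj \<phi> \<psi>) \<longleftrightarrow> polar X b \<phi> \<and> polar X b \<psi>"
| "polar X b (Disj \<phi> \<psi>) \<longleftrightarrow> polar X b \<phi> \<and> polar X b \<psi>"
| "polar X b (Impl \<phi> \<psi>) \<longleftrightarrow> polar X (\<not> b) \<phi> \<and> polar X b \<psi>"
| "polar X b (Forall v \<phi>) \<longleftrightarrow> polar X b \<phi>"
| "polar X b (Exists v \<phi>) \<longleftrightarrow> polar X b \<phi>"
| "polar X b (Lfp Y vs \<phi> ts) \<longleftrightarrow> (lfp_rvar Y vs = X \<or> polar X b \<phi>)"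

fun wff :: "signature \<Rightarrow> fm \<Rightarrow> bool" where
  "wff \<L> (Eq t u) \<longleftrightarrow> (\<exists>s. has_sort \<L> t s \<and> has_sort \<L> u s)"
| "wff \<L> (Rel R ts) \<longleftrightarrow> (\<exists>ss. rel_type \<L> R = Some ss \<and> list_all2 (has_sort \<L>) ts ss)"
| "wff \<L> (RVar Y ts) \<longleftrightarrow> list_all2 (has_sort \<L>) ts (snd Y)"
| "wff \<L> (Neg \<phi>) \<longleftrightarrow> wff \<L> \<phi>"
| "wff \<L> (Conj \<phi> \<psi>) \<longleftrightarrow> wff \<L> \<phi> \<and> wff \<L> \<psi>"
| "wff \<L> (Disj \<phi> \<psi>) \<longleftrightarrow> wff \<L> \<phi> \<and> wff \<L> \<psi>"
| "wff \<L> (Impl \<phi> \<psi>) \<longleftrightarrow> wff \<L> \<phi> \<and> wff \<L> \<psi>"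
| "wff \<L> (Forall v \<phi>) \<longleftrightarrow> fst v \<in> sorts \<L> \<and> wff \<L> \<phi>"
| "wff \<L> (Exists v \<phi>) \<longleftrightarrow> fst v \<in> sorts \<L> \<and> wff \<L> \<phi>"
| "wff \<L> (Lfp X vs \<phi> ts) \<longleftrightarrow>
     distinct vs \<and> polar (lfp_rvar X vs) True \<phi> \<and> wff \<L> \<phi> \<and>
     list_all2 (has_sort \<L>) ts (map fst vs)"

text \<open>Finite structures are taken with natural numbers as elements, which is no restriction up to
  isomorphism; the time domain is an initial segment \<open>{0..T}\<close> in its usual order.\<close>

record struct =
  dom :: "nat \<Rightarrow> nat set"
  fun_int :: "nat \<Rightarrow> nat list \<Rightarrow> nat"
  rel_int :: "nat \<Rightarrow> nat list set"

definition finite_structure :: "signature \<Rightarrow> struct \<Rightarrow> bool" where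
  "finite_structure \<L> M \<longleftrightarrow>
     (\<forall>s\<in>sorts \<L>. finite (dom M s) \<and> dom M s \<noteq> {}) \<and>
     (\<forall>f ss s. fun_type \<L> f = Some (ss, s) \<longrightarrow>
        (\<forall>xs\<in>listset (map (dom M) ss). fun_int M f xs \<in> dom M s)) \<and>
     (\<forall>R ss. rel_type \<L> R = Some ss \<longrightarrow> rel_int M R \<subseteq> listset (map (dom M) ss)) \<and>
     (\<exists>T. dom M (time_sort \<L>) = {0..T} \<and>
          rel_int M (time_le \<L>) = {[i, j] | i j. i \<le> j \<and> j \<le> T})"

fun tm_val :: "struct \<Rightarrow> (var \<Rightarrow> nat) \<Rightarrow> tm \<Rightarrow> nat" where
  "tm_val M a (Var v) = a v"
| "tm_val M a (App f ts) = fun_int M f (map (tm_val M a) ts)"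

fun sat :: "struct \<Rightarrow> (var \<Rightarrow> nat) \<Rightarrow> (rvar \<Rightarrow> nat list set) \<Rightarrow> fm \<Rightarrow> bool" where
  "sat M a r (Eq t u) \<longleftrightarrow> tm_val M a t = tm_val M a u"
| "sat M a r (Rel R ts) \<longleftrightarrow> map (tm_val M a) ts \<in> rel_int M R"
| "sat M a r (RVar Y ts) \<longleftrightarrow> map (tm_val M a) ts \<in> r Y"
| "sat M a r (Neg \<phi>) \<longleftrightarrow> \<not> sat M a r \<phi>"
| "sat M a r (Conj \<phi> \<psi>) \<longleftrightarrow> sat M a r \<phi> \<and> sat M a r \<psi>"
| "sat M a r (Disj \<phi> \<psi>) \<longleftrightarrow> sat M a r \<phi> \<or> sat M a r \<psi>"
| "sat M a r (Impl \<phi> \<psi>) \<longleftrightarrow> (sat M a r \<phi> \<longrightarrow> sat M a r \<psi>)"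
| "sat M a r (Forall v \<phi>) \<longleftrightarrow> (\<forall>x\<in>dom M (fst v). sat M (a(v := x)) r \<phi>)"
| "sat M a r (Exists v \<phi>) \<longleftrightarrow> (\<exists>x\<in>dom M (fst v). sat M (a(v := x)) r \<phi>)"
| "sat M a r (Lfp X vs \<phi> ts) \<longleftrightarrow>
     map (tm_val M a) ts \<in>
       lfp (\<lambda>Z. {xs \<in> listset (map (dom M \<circ> fst) vs).
                   sat M (\<lambda>v. case map_of (zip vs xs) v of Some x \<Rightarrow> x | None \<Rightarrow> a v)
                     (r(lfp_rvar X vs := Z)) \<phi>})"

fun tm_code :: "tm \<Rightarrow> nat" where
  "tm_code (Var v) = list_encode [0, prod_encode v]"
| "tm_code (App f ts) = list_encode (1 # f # map tm_code ts)"

definition tms_code :: "tm list \<Rightarrow> nat" where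
  "tms_code ts = list_encode (map tm_code ts)"

fun fm_code :: "fm \<Rightarrow> nat" where
  "fm_code (Eq t u) = list_encode [0, tm_code t, tm_code u]"
| "fm_code (Rel R ts) = list_encode [1, R, tms_code ts]"
| "fm_code (RVar Y ts) = list_encode [2, fst Y, list_encode (snd Y), tms_code ts]"
| "fm_code (Neg \<phi>) = list_encode [3, fm_code \<phi>]"
| "fm_code (Conj \<phi> \<psi>) = list_encode [4, fm_code \<phi>, fm_code \<psi>]"
| "fm_code (Disj \<phi> \<psi>) = list_encode [5, fm_code \<phi>, fm_code \<psi>]"
| "fm_code (Impl \<phi> \<psi>) = list_encode [6, fm_code \<phi>, fm_code \<psi>]"
| "fm_code (Forall v \<phi>) = list_encode [7, prod_encode v, fm_code \<phi>]"
| "fm_code (Exists v \<phi>) = list_encode [8, prod_encode v, fm_code \<phi>]"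
| "fm_code (Lfp X vs \<phi> ts) =
     list_encode [9, X, list_encode (map prod_encode vs), fm_code \<phi>, tms_code ts]"


section \<open>Proof systems\<close>

text \<open>A proof system is given by its single-step inferences, each consisting of the list of
  immediate premises and the conclusion; axioms are the steps without premises.\<close>

type_synonym inference = "fm list \<times> fm"

datatype deriv = Assumption fm | Step "deriv list" fm

fun conclusion :: "deriv \<Rightarrow> fm" where
  "conclusion (Assumption \<phi>) = \<phi>"
| "conclusion (Step ds \<phi>) = \<phi>"

fun is_proof :: "signature \<Rightarrow> inference set \<Rightarrow> deriv \<Rightarrow> bool" where
  "is_proof \<L> \<P> (Assumption \<phi>) \<longleftrightarrow> wff \<L> \<phi>"
| "is_proof \<L> \<P> (Step ds \<phi>) \<longleftrightarrow>
     (map conclusion ds, \<phi>) \<in> \<P> \<and> (\<forall>d\<in>set ds. is_proof \<L> \<P> d)"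

fun deriv_code :: "deriv \<Rightarrow> nat" where
  "deriv_code (Assumption \<phi>) = list_encode [0, fm_code \<phi>]"
| "deriv_code (Step ds \<phi>) = list_encode (1 # fm_code \<phi> # map deriv_code ds)"

definition effective_proof_system :: "signature \<Rightarrow> inference set \<Rightarrow> bool" where
  "effective_proof_system \<L> \<P> \<longleftrightarrow>
     (\<forall>(\<Gamma>, \<phi>)\<in>\<P>. (\<forall>\<psi>\<in>set \<Gamma>. wff \<L> \<psi>) \<and> wff \<L> \<phi>) \<and>
     decidable_on UNIV deriv_code (is_proof \<L> \<P>)"


section \<open>State spaces, predecessors and derivation depth\<close>

definition state_code :: "(fm \<Rightarrow> bool list) \<Rightarrow> fm \<Rightarrow> nat" where
  "state_code enc s = string_code (enc s)"

text \<open>Decidability of equality from the encodings forces \<open>enc\<close> to be injective on \<open>S\<close>.\<close>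

definition state_space :: "signature \<Rightarrow> fm set \<Rightarrow> (fm \<Rightarrow> bool list) \<Rightarrow> bool" where
  "state_space \<L> S enc \<longleftrightarrow>
     (\<forall>s\<in>S. wff \<L> s) \<and>
     decidable_on (S \<times> S) (\<lambda>(s, t). prod_encode (state_code enc s, state_code enc t))
       (\<lambda>(s, t). s = t)"

text \<open>One algorithm lists, from the encoding of \<open>s\<close>, the encodings of the predecessors of \<open>s\<close>
  (in some order, possibly with repetitions).\<close>

definition computable_predecessors ::
    "fm set \<Rightarrow> (fm \<Rightarrow> bool list) \<Rightarrow> (fm \<Rightarrow> fm set) \<Rightarrow> bool" where
  "computable_predecessors S enc P \<longleftrightarrow>
     (\<exists>l. (\<forall>s\<in>S. set (l s) = P s) \<and>
          computable_on S (state_code enc) (\<lambda>s. list_encode (map (state_code enc) (l s))))"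

definition well_founded_unfolding :: "fm set \<Rightarrow> (fm \<Rightarrow> fm set) \<Rightarrow> bool" where
  "well_founded_unfolding S P \<longleftrightarrow>
     (\<forall>s\<in>S. \<not> (\<exists>c. c 0 = s \<and> (\<forall>i::nat. c (Suc i) \<in> P (c i))))"

text \<open>\<open>nf s\<close> is the fixed normal-form inference step concluding \<open>s\<close>.\<close>

definition aligned ::
    "inference set \<Rightarrow> (fm \<Rightarrow> inference) \<Rightarrow> fm set \<Rightarrow> fm set \<Rightarrow> (fm \<Rightarrow> fm set) \<Rightarrow> bool" where
  "aligned \<P> nf S B P \<longleftrightarrow>
     (\<forall>s\<in>S - B. nf s \<in> \<P> \<and> snd (nf s) = s \<and> P s = set (fst (nf s)))"

text \<open>The recursion defining \<open>Dd(s | B)\<close> on \<open>S\<close>, for candidates that may take the value \<open>\<infinity>\<close>.\<close>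

definition is_derivation_depth ::
    "fm set \<Rightarrow> (fm \<Rightarrow> fm set) \<Rightarrow> fm set \<Rightarrow> (fm \<Rightarrow> enat) \<Rightarrow> bool" where
  "is_derivation_depth S P B Dd \<longleftrightarrow>
     (\<forall>s\<in>S. Dd s = (if s \<in> B then 0
                    else 1 + (if P s = {} then 0 else Max (Dd ` P s))))"

end

theory Submission imports Defs begin

text \<open>Let the frontier of \<open>s\<close> at level \<open>k\<close> consist of the states outside \<open>B\<close> that are reached from
  \<open>s\<close> by exactly \<open>k\<close> predecessor steps through states outside \<open>B\<close>. The derivation depth of \<open>s\<close>
  is the first level at which the frontier is empty. The frontiers are computed level by level
  by primitive recursion on encoded lists, and the first empty one is found by minimization, the
  empty list having the code 0. All states met on the way lie in \<open>S\<close>, so the given algorithms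
  for \<open>P\<close> and \<open>B\<close> are never run on other inputs.\<close>

section \<open>Closure properties of computable functions\<close>

text \<open>The machine reads the argument list \<open>env x\<close>, while \<open>x\<close> ranges
  over arbitrary points. Restricting \<open>A\<close> lets invariants of the inputs be assumed, as
  needed for algorithms that are correct only on codes of states.\<close>

definition computable_env :: "'a set \<Rightarrow> ('a \<Rightarrow> nat list) \<Rightarrow> ('a \<Rightarrow> nat) \<Rightarrow> bool" where
  "computable_env A env f \<longleftrightarrow> (\<exists>r. \<forall>x\<in>A. eval r (env x) = Some (f x))"

abbreviation computable1 :: "(nat \<Rightarrow> nat) \<Rightarrow> bool" where
  "computable1 h \<equiv> computable_env UNIV (\<lambda>x. [x]) h"

abbreviation computable2 :: "(nat \<Rightarrow> nat \<Rightarrow> nat) \<Rightarrow> bool" where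
  "computable2 h \<equiv> computable_env UNIV (\<lambda>(x, y). [x, y]) (\<lambda>(x, y). h x y)"

lemma computable_on_eq: "computable_on A e f \<longleftrightarrow> computable_env A (\<lambda>x. [e x]) f"
  by (simp add: computable_on_def computable_env_def)

text \<open>A machine sees only its argument list, so one program serves every index set whose
  inputs and outputs agree along \<open>h\<close>.\<close>

lemma computable_env_reindex:
  assumes "computable_env A' env' f'"
    and "\<And>x. x \<in> A \<Longrightarrow> h x \<in> A' \<and> env x = env' (h x) \<and> f x = f' (h x)"
  shows "computable_env A env f"
  using assms unfolding computable_env_def by metis

lemma computable_env_cong:
  assumes "computable_env A env f'" and "\<And>x. x \<in> A \<Longrightarrow> f x = f' x"
  shows "computable_env A env f"
  by (rule computable_env_reindex[OF assms(1), where h = "\<lambda>x. x"]) (simp add: assms(2))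

lemma computable_env_proj:
  assumes "\<And>x. x \<in> A \<Longrightarrow> i < length (env x) \<and> f x = env x ! i"
  shows "computable_env A env f"
  unfolding computable_env_def using assms by (intro exI[of _ "Proj i"]) auto

lemma computable_env_0: "computable_env A env (\<lambda>x. 0)"
  unfolding computable_env_def by (intro exI[of _ Zero]) auto

lemma those_map_Some: "those (map (\<lambda>x. Some (f x)) xs) = Some (map f xs)"
  by (induction xs) auto

text \<open>The outer machine has to be right only on the lists of values that arise from points of
  \<open>A\<close>, so algorithms with a restricted domain can be composed.\<close>

lemma computable_env_comp:
  assumes "list_all (computable_env A env) gs"
    and "computable_env A (\<lambda>x. map (\<lambda>g. g x) gs) f"
  shows "computable_env A env f"
proof -
  obtain rf where rf: "\<And>x. x \<in> A \<Longrightarrow> eval rf (map (\<lambda>g. g x) gs) = Some (f x)"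
    using assms(2) unfolding computable_env_def by blast
  obtain R where R: "\<And>g x. g \<in> set gs \<Longrightarrow> x \<in> A \<Longrightarrow> eval (R g) (env x) = Some (g x)"
    using assms(1) unfolding computable_env_def list_all_iff by metis
  have "eval (Comp rf (map R gs)) (env x) = Some (f x)" if x: "x \<in> A" for x
  proof -
    have "map (\<lambda>g. eval g (env x)) (map R gs) = map (\<lambda>g. Some (g x)) gs"
      using R x by auto
    then show ?thesis using rf[OF x] by (simp only: eval.simps those_map_Some bind.bind_lunit)
  qed
  then show ?thesis unfolding computable_env_def by blast
qed

lemma computable_env_comp1:
  assumes "computable_env A' (\<lambda>y. [y]) h" and "computable_env A env g"
    and "\<And>x. x \<in> A \<Longrightarrow> g x \<in> A'"
  shows "computable_env A env (\<lambda>x. h (g x))"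
proof (rule computable_env_comp[of _ _ "[g]"])
  show "computable_env A (\<lambda>x. map (\<lambda>g. g x) [g]) (\<lambda>x. h (g x))"
    by (rule computable_env_reindex[OF assms(1), where h = g]) (simp add: assms(3))
qed (use assms(2) in simp)

lemma computable_env_total1:
  assumes "computable1 h" and "computable_env A env g"
  shows "computable_env A env (\<lambda>x. h (g x))"
  using assms by (rule computable_env_comp1) simp

lemma computable_env_comp2:
  assumes "computable_env A' (\<lambda>(x, y). [x, y]) (\<lambda>(x, y). h x y)"
    and "computable_env A env g1" and "computable_env A env g2"
    and "\<And>x. x \<in> A \<Longrightarrow> (g1 x, g2 x) \<in> A'"
  shows "computable_env A env (\<lambda>x. h (g1 x) (g2 x))"
proof (rule computable_env_comp[of _ _ "[g1, g2]"])
  show "computable_env A (\<lambda>x. map (\<lambda>g. g x) [g1, g2]) (\<lambda>x. h (g1 x) (g2 x))"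
    by (rule computable_env_reindex[OF assms(1), where h = "\<lambda>x. (g1 x, g2 x)"])
      (simp add: assms(4))
qed (use assms(2,3) in simp)

lemma computable_env_total2:
  assumes "computable2 h" and "computable_env A env g1" and "computable_env A env g2"
  shows "computable_env A env (\<lambda>x. h (g1 x) (g2 x))"
  using assms by (rule computable_env_comp2) simp

lemma computable_env_Suc:
  assumes "computable_env A env g"
  shows "computable_env A env (\<lambda>x. Suc (g x))"
proof (rule computable_env_total1[OF _ assms])
  show "computable1 Suc" unfolding computable_env_def by (intro exI[of _ Succ]) simp
qed

text \<open>Weakening by \<open>k\<close> leading arguments: projections past them rebuild the old
  environment.\<close>

lemma computable_env_tail:
  assumes "computable_env A env f" and "\<And>x. x \<in> A \<Longrightarrow> length (env x) = n"
    and "\<And>p. p \<in> A' \<Longrightarrow> h p \<in> A \<and> drop k (env' p) = env (h p)"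
  shows "computable_env A' env' (\<lambda>p. f (h p))"
proof (rule computable_env_comp[of _ _ "map (\<lambda>i p. env' p ! (k + i)) [0..<n]"])
  \<comment> \<open>For \<open>n = 0\<close> the list may be shorter than \<open>k\<close>, but then
    no projection is taken.\<close>
  have len: "length (env' p) = k + n \<or> n = 0" if "p \<in> A'" for p
    using assms(2)[of "h p"] assms(3)[OF that] length_drop[of k "env' p"] by auto
  show "list_all (computable_env A' env') (map (\<lambda>i p. env' p ! (k + i)) [0..<n])"
    unfolding list_all_iff
  proof
    fix g assume "g \<in> set (map (\<lambda>i p. env' p ! (k + i)) [0..<n])"
    then obtain i where "i < n" "g = (\<lambda>p. env' p ! (k + i))" by auto
    then show "computable_env A' env' g"
      using len by (intro computable_env_proj[of _ "k + i"]) force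
  qed
  have "map (\<lambda>i. env' p ! (k + i)) [0..<n] = env (h p)" if "p \<in> A'" for p
    using assms(2)[of "h p"] assms(3)[OF that] len[OF that]
    by (intro nth_equalityI) (auto simp flip: nth_drop)
  then show "computable_env A' (\<lambda>p. map (\<lambda>g. g p) (map (\<lambda>i p. env' p ! (k + i)) [0..<n])) (\<lambda>p. f (h p))"
    by (intro computable_env_reindex[OF assms(1), where h = h]) (use assms(3) in \<open>auto simp: comp_def\<close>)
qed

text \<open>An induction bounded by \<open>n x\<close> suffices, so the step has to be computed only
  at counters below \<open>n x\<close> and at values the recursion really takes; invariants of these
  values may be used. The fixed length \<open>m\<close> allows the environment to be copied by
  \<open>m\<close> projections.\<close>

lemma computable_env_rec:
  assumes "computable_env A env n" and "computable_env A env b"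
    and "computable_env {(x, k). x \<in> A \<and> k < n x}
           (\<lambda>(x, k). k # rec_nat (b x) (s x) k # env x)
           (\<lambda>(x, k). s x k (rec_nat (b x) (s x) k))"
    and len: "\<And>x. x \<in> A \<Longrightarrow> length (env x) = m"
  shows "computable_env A env (\<lambda>x. rec_nat (b x) (s x) (n x))"
proof (rule computable_env_comp[of _ _ "n # map (\<lambda>i x. env x ! i) [0..<m]"])
  show "list_all (computable_env A env) (n # map (\<lambda>i x. env x ! i) [0..<m])"
    using assms(1) len by (auto simp: list_all_iff intro: computable_env_proj)
  obtain rb where rb: "\<And>x. x \<in> A \<Longrightarrow> eval rb (env x) = Some (b x)"
    using assms(2) unfolding computable_env_def by blast
  obtain rs where rs: "\<And>x k. x \<in> A \<Longrightarrow> k < n x \<Longrightarrow>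
      eval rs (k # rec_nat (b x) (s x) k # env x) = Some (s x k (rec_nat (b x) (s x) k))"
    using assms(3) unfolding computable_env_def by auto
  have "rec_nat (eval rb (env x)) (\<lambda>k v. Option.bind v (\<lambda>v. eval rs (k # v # env x))) k
      = Some (rec_nat (b x) (s x) k)" if "x \<in> A" "k \<le> n x" for x k
    using that(2) by (induction k) (use that(1) rb rs in auto)
  moreover have "map (\<lambda>i. env x ! i) [0..<m] = env x" if "x \<in> A" for x
    using len[OF that] map_nth by blast
  ultimately show "computable_env A (\<lambda>x. map (\<lambda>g. g x) (n # map (\<lambda>i x. env x ! i) [0..<m]))
      (\<lambda>x. rec_nat (b x) (s x) (n x))"
    unfolding computable_env_def by (intro exI[of _ "PrimRec rb rs"]) (auto simp: comp_def)
qed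

text \<open>Minimality makes all earlier values successors; with the zero at the end this is the
  halting condition of \<open>Mu\<close>.\<close>

lemma computable_env_Least:
  assumes "computable_env {(x, k). x \<in> A} (\<lambda>(x, k). k # env x) (\<lambda>(x, k). f x k)"
    and ex: "\<And>x. x \<in> A \<Longrightarrow> \<exists>k. f x k = 0"
  shows "computable_env A env (\<lambda>x. LEAST k. f x k = 0)"
proof -
  obtain r where r: "\<And>x k. x \<in> A \<Longrightarrow> eval r (k # env x) = Some (f x k)"
    using assms(1) unfolding computable_env_def by auto
  have "eval (Mu r) (env x) = Some (LEAST k. f x k = 0)" if x: "x \<in> A" for x
  proof -
    have "f x (LEAST k. f x k = 0) = 0" using ex[OF x] by (rule LeastI_ex)
    moreover have "\<exists>v. f x m = Suc v" if "m < (LEAST k. f x k = 0)" for m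
      using not_less_Least[OF that] not0_implies_Suc by blast
    ultimately show ?thesis using r[OF x] by auto
  qed
  then show ?thesis unfolding computable_env_def by blast
qed

section \<open>Arithmetic, pairs and lists\<close>

lemma computable_add:
  assumes "computable_env A env f" and "computable_env A env g"
  shows "computable_env A env (\<lambda>x. f x + g x)"
proof (rule computable_env_total2[OF _ assms])
  have eq: "rec_nat x (\<lambda>_ v. Suc v) y = x + y" for x y :: nat by (induction y) auto
  have "computable_env UNIV (\<lambda>(x, y). [x, y])
      (\<lambda>p. rec_nat (fst p) ((\<lambda>p k v. Suc v) p) (snd p))"
    by (rule computable_env_rec[where m = 2])
      (auto simp: case_prod_unfold intro!: computable_env_Suc
        intro: computable_env_proj[of _ 0] computable_env_proj[of _ 1])
  then show "computable2 (+)" by (rule computable_env_cong) (auto simp: eq)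
qed

lemma computable_pred:
  assumes "computable_env A env f"
  shows "computable_env A env (\<lambda>x. f x - Suc 0)"
proof (rule computable_env_total1[OF _ assms])
  have eq: "rec_nat 0 (\<lambda>k v. k) y = y - Suc 0" for y :: nat by (cases y) auto
  have "computable_env UNIV (\<lambda>x. [x]) (\<lambda>p. rec_nat 0 ((\<lambda>p k v. k) p) p)"
    by (rule computable_env_rec[where m = 1])
      (auto simp: case_prod_unfold intro!: computable_env_0
        intro: computable_env_proj[of _ 0])
  then show "computable1 (\<lambda>x. x - Suc 0)" by (rule computable_env_cong) (auto simp: eq)
qed

lemma computable_diff:
  assumes "computable_env A env f" and "computable_env A env g"
  shows "computable_env A env (\<lambda>x. f x - g x)"
proof (rule computable_env_total2[OF _ assms])
  have eq: "rec_nat x (\<lambda>_ v. v - Suc 0) y = x - y" for x y :: nat by (induction y) auto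
  have "computable_env UNIV (\<lambda>(x, y). [x, y])
      (\<lambda>p. rec_nat (fst p) ((\<lambda>p k v. v - Suc 0) p) (snd p))"
    by (rule computable_env_rec[where m = 2])
      (auto simp: case_prod_unfold intro!: computable_pred
        intro: computable_env_proj[of _ 0] computable_env_proj[of _ 1])
  then show "computable2 (-)" by (rule computable_env_cong) (auto simp: eq)
qed

lemma computable_triangle:
  assumes "computable_env A env f"
  shows "computable_env A env (\<lambda>x. triangle (f x))"
proof (rule computable_env_total1[OF _ assms])
  have eq: "rec_nat 0 (\<lambda>k v. v + Suc k) y = triangle y" for y :: nat by (induction y) auto
  have "computable_env UNIV (\<lambda>x. [x]) (\<lambda>p. rec_nat 0 ((\<lambda>p k v. v + Suc k) p) p)"
    by (rule computable_env_rec[where m = 1])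
      (auto simp: case_prod_unfold simp del: add_Suc_right
        intro!: computable_env_0 computable_add computable_env_Suc
        intro: computable_env_proj[of _ 0] computable_env_proj[of _ 1])
  then show "computable1 triangle" by (rule computable_env_cong) (simp only: eq)
qed

section \<open>Inverting the Cantor pairing function\<close>

lemma triangle_mono: "m \<le> n \<Longrightarrow> triangle m \<le> triangle n"
  by (induction n rule: dec_induct) auto

text \<open>\<open>prod_encode (a, b)\<close> lies between \<open>triangle (a + b)\<close> and \<open>triangle (Suc (a + b))\<close>.\<close>

lemma Least_triangle_prod_encode:
  "(LEAST w. Suc (prod_encode (a, b)) - triangle (Suc w) = 0) = a + b"
proof (rule Least_equality)
  fix w assume w: "Suc (prod_encode (a, b)) - triangle (Suc w) = 0"
  show "a + b \<le> w"
  proof (rule ccontr)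
    assume "\<not> a + b \<le> w"
    then have "triangle (Suc w) \<le> triangle (a + b)" by (intro triangle_mono) auto
    then show False using w by (simp add: prod_encode_def)
  qed
qed (simp add: prod_encode_def)

text \<open>For \<open>z = prod_encode (a, b)\<close> the diagonal \<open>w = a + b\<close> is found
  by minimization; then \<open>a = z - triangle w\<close> and \<open>b = w - a\<close>.\<close>

lemma computable_fst_snd_decode:
  assumes "computable_env A env f"
  shows "computable_env A env (\<lambda>x. fst (prod_decode (f x)))"
    and "computable_env A env (\<lambda>x. snd (prod_decode (f x)))"
proof -
  \<comment> \<open>By truncated subtraction the condition says
    \<open>z < triangle (Suc w)\<close>.\<close>
  define w where "w z = (LEAST w. Suc z - triangle (Suc w) = 0)" for z
  have w: "computable1 w"
    unfolding w_def
  proof (rule computable_env_Least)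
    show "computable_env {(x, k). x \<in> UNIV} (\<lambda>(x, k). [k, x]) (\<lambda>(x, k). Suc x - triangle (Suc k))"
      by (auto simp: case_prod_unfold simp del: triangle_Suc
          intro!: computable_diff computable_triangle computable_env_Suc
          intro: computable_env_proj[of _ 0] computable_env_proj[of _ 1])
    show "\<exists>k. Suc z - triangle (Suc k) = 0" for z by (intro exI[of _ z]) simp
  qed
  have eq: "fst (prod_decode z) = z - triangle (w z)
      \<and> snd (prod_decode z) = w z - (z - triangle (w z))" for z
  proof -
    obtain a b where z: "z = prod_encode (a, b)" by (metis prod_decode_inverse surj_pair)
    have "w z = a + b" unfolding w_def z by (rule Least_triangle_prod_encode)
    then show ?thesis by (simp add: z) (simp add: prod_encode_def)
  qed
  note wf = computable_env_total1[OF w assms]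
  show "computable_env A env (\<lambda>x. fst (prod_decode (f x)))"
    and "computable_env A env (\<lambda>x. snd (prod_decode (f x)))"
    unfolding eq[THEN conjunct1] eq[THEN conjunct2]
    by (intro computable_diff computable_triangle wf assms)+
qed

lemma computable_prod_encode:
  assumes "computable_env A env f" and "computable_env A env g"
  shows "computable_env A env (\<lambda>x. prod_encode (f x, g x))"
  unfolding prod_encode_def prod.case by (intro computable_add computable_triangle assms)

section \<open>Numerical codes of lists\<close>

definition hd_code :: "nat \<Rightarrow> nat" where
  "hd_code z = fst (prod_decode (z - Suc 0))"

text \<open>A nonempty list has the code \<open>Suc (prod_encode (x, c))\<close>, with
  \<open>c\<close> the code of its tail; each round strips the successor and keeps
  \<open>c\<close>.\<close>

definition drop_code :: "nat \<Rightarrow> nat \<Rightarrow> nat" where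
  "drop_code z k = rec_nat z (\<lambda>_ v. snd (prod_decode (v - Suc 0))) k"

lemma drop_code: "drop_code (list_encode xs) k = list_encode (drop k xs)"
proof (induction k)
  case (Suc k)
  \<comment> \<open>This covers the empty list: its code 0 is a fixed point of the round, matching
    \<open>tl [] = []\<close>.\<close>
  have "snd (prod_decode 0) = 0" by (simp add: prod_decode_def prod_decode_aux.simps)
  then have "snd (prod_decode (list_encode ys - Suc 0)) = list_encode (tl ys)" for ys
    by (cases ys) auto
  then show ?case using Suc by (simp add: drop_code_def drop_Suc tl_drop)
qed (simp add: drop_code_def)

lemma list_encode_eq_0: "list_encode xs = 0 \<longleftrightarrow> xs = []"
  by (cases xs) auto

lemma hd_code_drop_code:
  assumes "k < length xs"
  shows "hd_code (drop_code (list_encode xs) k) = xs ! k"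
proof -
  have "drop k xs = xs ! k # drop (Suc k) xs" using assms by (simp add: Cons_nth_drop_Suc)
  then show ?thesis by (simp add: drop_code hd_code_def)
qed

lemma computable_drop_code:
  assumes "computable_env A env f" and "computable_env A env g"
  shows "computable_env A env (\<lambda>x. drop_code (f x) (g x))"
proof (rule computable_env_total2[OF _ assms])
  have "computable_env UNIV (\<lambda>(x, y). [x, y])
      (\<lambda>p. rec_nat (fst p) ((\<lambda>p k v. snd (prod_decode (v - Suc 0))) p) (snd p))"
    by (rule computable_env_rec[where m = 2])
      (auto simp: case_prod_unfold intro!: computable_fst_snd_decode computable_pred
        intro: computable_env_proj[of _ 0] computable_env_proj[of _ 1])
  then show "computable2 drop_code"
    by (rule computable_env_cong) (auto simp: drop_code_def)
qed

lemma computable_hd_code: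
  assumes "computable_env A env f"
  shows "computable_env A env (\<lambda>x. hd_code (f x))"
  unfolding hd_code_def by (intro computable_fst_snd_decode computable_pred assms)

text \<open>The length is the least number of dropped entries after which the code is 0.\<close>

lemma computable_length:
  assumes "computable_env A env (\<lambda>x. list_encode (L x))"
  shows "computable_env A env (\<lambda>x. length (L x))"
proof -
  have len: "computable1 (\<lambda>z. LEAST k. drop_code z k = 0)"
  proof (rule computable_env_Least)
    show "computable_env {(x, k). x \<in> UNIV} (\<lambda>(x, k). [k, x]) (\<lambda>(x, k). drop_code x k)"
      by (auto simp: case_prod_unfold intro!: computable_drop_code
          intro: computable_env_proj[of _ 0] computable_env_proj[of _ 1])
    \<comment> \<open>Every number codes some list, so the search halts on all inputs.\<close>
    show "\<exists>k. drop_code z k = 0" for z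
      using drop_code[of "list_decode z" "length (list_decode z)"] by auto
  qed
  have "(LEAST k. drop_code (list_encode xs) k = 0) = length xs" for xs
    by (rule Least_equality) (auto simp: drop_code list_encode_eq_0)
  then show ?thesis using computable_env_total1[OF len assms] by simp
qed

text \<open>Primitive recursion on the position in the list, with the entry at that position
  extracted from the code in each round. The operation has to be computed only at entries of
  \<open>L x\<close>.\<close>

lemma computable_fold:
  assumes L: "computable_env A env (\<lambda>x. list_encode (L x))" and a: "computable_env A env a"
    and g: "computable_env {(x, y, v). x \<in> A \<and> y \<in> set (L x)}
           (\<lambda>(x, y, v). y # v # env x) (\<lambda>(x, y, v). g x y v)"
    and len: "\<And>x. x \<in> A \<Longrightarrow> length (env x) = m"
  shows "computable_env A env (\<lambda>x. fold (g x) (L x) (a x))"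
proof -
  define s where "s x k v = g x (L x ! k) v" for x k v
  let ?r = "\<lambda>x k. rec_nat (a x) (s x) k"
  let ?A' = "{(x, k). x \<in> A \<and> k < length (L x)}"
  let ?env' = "\<lambda>(x, k). k # ?r x k # env x"
  have eq: "?r x k = fold (g x) (take k (L x)) (a x)" if "k \<le> length (L x)" for x k
    using that by (induction k) (auto simp: s_def take_Suc_conv_app_nth)
  \<comment> \<open>The two extra arguments are the counter and the accumulator.\<close>
  have L': "computable_env ?A' ?env' (\<lambda>p. list_encode (L (fst p)))"
    by (rule computable_env_tail[OF L len, of ?A' fst 2]) auto
  have nth: "computable_env ?A' ?env' (\<lambda>(x, k). L x ! k)"
  proof (rule computable_env_cong)
    show "computable_env ?A' ?env' (\<lambda>p. hd_code (drop_code (list_encode (L (fst p))) (snd p)))"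
      by (intro computable_hd_code computable_drop_code L' computable_env_proj[of _ 0]) auto
  qed (auto simp: hd_code_drop_code)
  have env: "computable_env ?A' ?env' (\<lambda>p. env (fst p) ! i)" if "i < m" for i
    using that len by (intro computable_env_proj[of _ "i + 2"]) auto
  \<comment> \<open>The machine for \<open>g\<close> expects the list entry where the recursion
    supplies the counter; the other arguments are passed on.\<close>
  have "computable_env ?A' ?env' (\<lambda>(x, k). s x k (?r x k))"
  proof (rule computable_env_comp[of _ _ "(\<lambda>(x, k). L x ! k) # (\<lambda>(x, k). ?r x k)
        # map (\<lambda>i p. env (fst p) ! i) [0..<m]"], goal_cases)
    case 1
    show ?case
      using nth env by (auto simp: list_all_iff intro: computable_env_proj[of _ 1])
  next
    case 2
    have "map (\<lambda>i. env x ! i) [0..<m] = env x" if "x \<in> A" for x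
      using len[OF that] map_nth by blast
    then show ?case
      by (intro computable_env_reindex[OF g, where h = "\<lambda>(x, k). (x, L x ! k, ?r x k)"])
        (auto simp: s_def comp_def)
  qed
  then have "computable_env A env (\<lambda>x. ?r x (length (L x)))"
    by (rule computable_env_rec[OF computable_length[OF L] a _ len])
  then show ?thesis by (rule computable_env_cong) (simp add: eq)
qed

lemma computable_fold2:
  assumes h: "computable_env (Y \<times> UNIV) (\<lambda>(y, v). [y, v]) (\<lambda>(y, v). h y v)"
    and L: "computable_env A env (\<lambda>x. list_encode (L x))" and a: "computable_env A env a"
    and len: "\<And>x. x \<in> A \<Longrightarrow> length (env x) = m"
    and Y: "\<And>x. x \<in> A \<Longrightarrow> set (L x) \<subseteq> Y"
  shows "computable_env A env (\<lambda>x. fold h (L x) (a x))"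
proof (rule computable_fold[OF L a _ len])
  show "computable_env {(x, y, v). x \<in> A \<and> y \<in> set (L x)}
      (\<lambda>(x, y, v). y # v # env x) (\<lambda>(x, y, v). h y v)"
    unfolding case_prod_unfold
    by (rule computable_env_comp2[OF h])
      (use subsetD[OF Y] in \<open>auto intro: computable_env_proj[of _ 0] computable_env_proj[of _ 1]\<close>)
qed

section \<open>Frontiers\<close>

fun frontier :: "('a \<Rightarrow> 'a set) \<Rightarrow> 'a set \<Rightarrow> 'a \<Rightarrow> nat \<Rightarrow> 'a set" where
  "frontier P B s 0 = {s} - B"
| "frontier P B s (Suc k) = \<Union> (P ` frontier P B s k) - B"

text \<open>The definition peels off the last predecessor step; peeling off the first one instead
  matches the recursion for the derivation depth.\<close>

lemma frontier_Suc_eq: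
  "frontier P B s (Suc k) = (if s \<in> B then {} else \<Union>t\<in>P s. frontier P B t k)"
  by (induction k) (auto split: if_splits)

lemma frontier_empty_mono:
  assumes "frontier P B s k = {}" and "k \<le> n"
  shows "frontier P B s n = {}"
  using assms(2,1) by (induction n rule: dec_induct) auto

lemma frontier_subset:
  assumes "\<And>s. s \<in> S \<Longrightarrow> P s \<subseteq> S" and "s \<in> S"
  shows "frontier P B s k \<subseteq> S"
  by (induction k) (use assms in auto)

lemma well_founded_unfolding_wf:
  assumes "well_founded_unfolding S P" and "\<And>s. s \<in> S \<Longrightarrow> P s \<subseteq> S"
  shows "wf {(t, s). s \<in> S \<and> t \<in> P s}"
  unfolding wf_iff_no_infinite_down_chain
proof
  assume "\<exists>c. \<forall>i. (c (Suc i), c i) \<in> {(t, s). s \<in> S \<and> t \<in> P s}"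
  then obtain c where "\<And>i::nat. c i \<in> S \<and> c (Suc i) \<in> P (c i)" by auto
  then show False using assms(1) unfolding well_founded_unfolding_def by metis
qed

text \<open>By well-founded induction each predecessor has an empty level; as there are finitely
  many, the maximum of these levels works for all of them.\<close>

lemma frontier_eventually_empty:
  assumes "wf {(t, s). s \<in> S \<and> t \<in> P s}"
    and "\<And>s. s \<in> S \<Longrightarrow> P s \<subseteq> S" and "\<And>s. s \<in> S \<Longrightarrow> finite (P s)" and "s \<in> S"
  shows "\<exists>k. frontier P B s k = {}"
  using assms(1,4)
proof (induction s rule: wf_induct_rule)
  case (less s)
  then have "\<forall>t\<in>P s. \<exists>k. frontier P B t k = {}" using assms(2) by blast
  then obtain K where K: "\<And>t. t \<in> P s \<Longrightarrow> frontier P B t (K t) = {}" by metis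
  have "frontier P B t (Max (K ` P s)) = {}" if "t \<in> P s" for t
    using that assms(3)[OF less.prems] by (intro frontier_empty_mono[OF K[OF that]]) auto
  \<comment> \<open>If \<open>P s\<close> is empty, the value of \<open>Max\<close> is unspecified
    but harmless, since the union is empty.\<close>
  then have "frontier P B s (Suc (Max (K ` P s))) = {}" unfolding frontier_Suc_eq by simp
  then show ?case by blast
qed

section \<open>Derivation depth as the first empty level\<close>

definition depth :: "('a \<Rightarrow> 'a set) \<Rightarrow> 'a set \<Rightarrow> 'a \<Rightarrow> nat" where
  "depth P B s = (LEAST k. frontier P B s k = {})"

lemma depth_le_iff:
  assumes "\<exists>k. frontier P B s k = {}"
  shows "depth P B s \<le> n \<longleftrightarrow> frontier P B s n = {}"
  unfolding depth_def
  using LeastI_ex[OF assms] frontier_empty_mono[of P B s _ n] by (auto intro: Least_le)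

text \<open>Bounds on the depth are emptiness statements about frontiers. The bound 0 characterizes
  \<open>B\<close>, and outside \<open>B\<close> the bound \<open>Suc n\<close> on \<open>s\<close>
  is the bound \<open>n\<close> on all its predecessors; this determines the maximum.\<close>

lemma is_derivation_depth_depth:
  assumes closed: "\<And>s. s \<in> S \<Longrightarrow> P s \<subseteq> S" and fin: "\<And>s. s \<in> S \<Longrightarrow> finite (P s)"
    and ex: "\<And>s. s \<in> S \<Longrightarrow> \<exists>k. frontier P B s k = {}"
  shows "is_derivation_depth S P B (\<lambda>s. enat (depth P B s))"
  unfolding is_derivation_depth_def
proof
  fix s assume s: "s \<in> S"
  let ?d = "depth P B"
  have le_0: "?d s \<le> 0 \<longleftrightarrow> s \<in> B" using depth_le_iff[OF ex[OF s], of 0] by auto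
  have le_Suc: "?d s \<le> Suc n \<longleftrightarrow> (\<forall>t\<in>P s. ?d t \<le> n)" if "s \<notin> B" for n
  proof -
    have "?d t \<le> n \<longleftrightarrow> frontier P B t n = {}" if "t \<in> P s" for t
      using closed[OF s] that by (intro depth_le_iff ex) (rule subsetD)
    then show ?thesis
      using that by (simp add: depth_le_iff[OF ex[OF s]] frontier_Suc_eq del: frontier.simps)
  qed
  show "enat (?d s) = (if s \<in> B then 0
      else 1 + (if P s = {} then 0 else Max ((\<lambda>s. enat (?d s)) ` P s)))"
  proof (cases "s \<in> B \<or> P s = {}")
    case True
    \<comment> \<open>Outside \<open>B\<close> and without predecessors the depth is at most 1 and
      not 0.\<close>
    then show ?thesis using le_0 le_Suc[of 0] by (auto simp: one_enat_def zero_enat_def)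
  next
    case False
    have "?d s = Suc (Max (?d ` P s))"
    proof (rule antisym)
      show "?d s \<le> Suc (Max (?d ` P s))" using False le_Suc fin[OF s] by auto
      obtain n where n: "?d s = Suc n" using le_0 False by (cases "?d s") auto
      then have "\<forall>t\<in>P s. ?d t \<le> n" using le_Suc[of n] False by simp
      then show "Suc (Max (?d ` P s)) \<le> ?d s" using n False fin[OF s] by auto
    qed
    \<comment> \<open>The monotone map \<open>enat\<close> commutes with the maximum of a finite
      nonempty set.\<close>
    moreover have "Max ((\<lambda>s. enat (?d s)) ` P s) = enat (Max (?d ` P s))"
      using mono_Max_commute[of enat "?d ` P s"] False fin[OF s]
      by (simp add: image_image mono_def)
    ultimately show ?thesis using False by (simp add: one_enat_def)
  qed
qed

text \<open>Well-founded induction: at \<open>s\<close> the recursion reads a candidate only on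
  \<open>P s\<close>, where both agree already.\<close>

lemma is_derivation_depth_unique:
  assumes "wf {(t, s). s \<in> S \<and> t \<in> P s}" and "\<And>s. s \<in> S \<Longrightarrow> P s \<subseteq> S"
    and "is_derivation_depth S P B D" and "is_derivation_depth S P B D'" and "s \<in> S"
  shows "D' s = D s"
  using assms(1,5)
proof (induction s rule: wf_induct_rule)
  case (less s)
  then have "D' ` P s = D ` P s" using assms(2) by (intro image_cong) auto
  then show ?case
    using assms(3,4) less.prems unfolding is_derivation_depth_def by metis
qed

text \<open>The machine handles only numbers. Each code of a level is tied to some list of states
  whose set is the frontier; order and repetitions do not affect whether it is empty.\<close>

lemma computable_depth:
  assumes pred: "computable_on S e (\<lambda>s. list_encode (map e (l s)))"
    and l: "\<And>s. s \<in> S \<Longrightarrow> set (l s) = P s"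
    and dec: "decidable_on S e (\<lambda>s. s \<in> B)"
    and closed: "\<And>s. s \<in> S \<Longrightarrow> P s \<subseteq> S"
    and ex: "\<And>s. s \<in> S \<Longrightarrow> \<exists>k. frontier P B s k = {}"
  shows "computable_on S e (depth P B)"
proof -
  obtain rP where rP: "\<And>s. s \<in> S \<Longrightarrow> eval rP [e s] = Some (list_encode (map e (l s)))"
    using pred unfolding computable_on_def by blast
  obtain rB where rB: "\<And>s. s \<in> S \<Longrightarrow> eval rB [e s] = Some (of_bool (s \<in> B))"
    using dec unfolding decidable_on_def computable_on_def by blast
  define p where "p n = list_decode (the (eval rP [n]))" for n
  define b where "b n = the (eval rB [n])" for n
  have p: "p (e s) = map e (l s)" if "s \<in> S" for s using rP[OF that] by (simp add: p_def)
  have b: "b (e s) = of_bool (s \<in> B)" if "s \<in> S" for s using rB[OF that] by (simp add: b_def)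
  have comp_p: "computable_env (e ` S) (\<lambda>y. [y]) (\<lambda>y. list_encode (p y))"
    unfolding computable_env_def by (intro exI[of _ rP]) (auto simp: rP p)
  have comp_b: "computable_env (e ` S) (\<lambda>y. [y]) b"
    unfolding computable_env_def by (intro exI[of _ rB]) (auto simp: rB b)

  \<comment> \<open>The recursion is a case distinction on \<open>b y\<close>, which is 0 or 1: a
    code outside \<open>B\<close> is prepended to the list coded by \<open>v\<close>, one in
    \<open>B\<close> leaves \<open>v\<close> as it is.\<close>
  define add where "add y v = rec_nat (Suc (prod_encode (y, v))) (\<lambda>_ _. v) (b y)" for y v
  define out where "out ys v = fold add ys v" for ys v
  have add: "computable_env (e ` S \<times> UNIV) (\<lambda>(y, v). [y, v]) (\<lambda>(y, v). add y v)"
    unfolding add_def case_prod_unfold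
  proof (rule computable_env_rec[where m = 2])
    show "computable_env (e ` S \<times> UNIV) (\<lambda>q. [fst q, snd q]) (\<lambda>q. b (fst q))"
      by (rule computable_env_comp1[OF comp_b]) (auto intro: computable_env_proj[of _ 0])
    show "computable_env (e ` S \<times> UNIV) (\<lambda>q. [fst q, snd q]) (\<lambda>q. Suc (prod_encode (fst q, snd q)))"
      by (intro computable_env_Suc computable_prod_encode)
        (auto intro: computable_env_proj[of _ 0] computable_env_proj[of _ 1])
  \<comment> \<open>The step sees the counter, the accumulator, \<open>y\<close> and
    \<open>v\<close> in this order, so \<open>v\<close> has index 3.\<close>
  qed (auto intro!: computable_env_proj[of _ 3])
  define step where "step v = fold (\<lambda>y. out (p y)) (list_decode v) 0" for v
  \<comment> \<open>Level 0 filters the single state \<open>x\<close> into the empty list, whose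
    code is 0.\<close>
  define F where "F x k = rec_nat (out [e x] 0) (\<lambda>_ v. step v) k" for x k
  have out: "\<exists>zs. out (map e xs) (list_encode (map e ys)) = list_encode (map e zs)
      \<and> set zs = set xs - B \<union> set ys" if "set xs \<subseteq> S" for xs ys
    using that unfolding out_def
  proof (induction xs arbitrary: ys)
    case (Cons x xs)
    define ys' where "ys' = (if x \<in> B then ys else x # ys)"
    have "add (e x) (list_encode (map e ys)) = list_encode (map e ys')"
      using Cons.prems by (auto simp: add_def b ys'_def)
    moreover have "set xs - B \<union> set ys' = set (x # xs) - B \<union> set ys" by (auto simp: ys'_def)
    ultimately show ?case using Cons.IH[of ys'] Cons.prems by auto
  qed auto
  \<comment> \<open>The accumulator \<open>ys\<close> is arbitrary for the sake of the induction;
    levels are built from the empty one.\<close>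
  have step: "\<exists>zs. fold (\<lambda>y. out (p y)) (map e xs) (list_encode (map e ys)) = list_encode (map e zs)
      \<and> set zs = \<Union> (P ` set xs) - B \<union> set ys" if "set xs \<subseteq> S" for xs ys
    using that
  proof (induction xs arbitrary: ys)
    case (Cons x xs)
    then have x: "x \<in> S" and xs: "set xs \<subseteq> S" by auto
    obtain ys' where ys': "out (p (e x)) (list_encode (map e ys)) = list_encode (map e ys')"
      "set ys' = P x - B \<union> set ys"
      using out[of "l x" ys] l[OF x] closed[OF x] p[OF x] by auto
    show ?case using Cons.IH[OF xs, of ys'] ys' by auto
  qed auto
  have F: "\<exists>zs. F x k = list_encode (map e zs) \<and> set zs = frontier P B x k" if "x \<in> S" for x k
  proof (induction k)
    case 0
    show ?case using out[of "[x]" "[]"] that by (simp add: F_def)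
  next
    case (Suc k)
    then obtain zs where zs: "F x k = list_encode (map e zs)" "set zs = frontier P B x k" by blast
    then have "set zs \<subseteq> S" using frontier_subset closed that by metis
    then show ?case using step[of zs "[]"] zs by (simp add: F_def step_def)
  qed
  have step_comp: "computable_env {v. set (list_decode v) \<subseteq> e ` S} (\<lambda>v. [v]) step"
    unfolding step_def
  proof (rule computable_fold2[where m = 1])
    show "computable_env (e ` S \<times> UNIV) (\<lambda>(y, v). [y, v]) (\<lambda>(y, v). out (p y) v)"
      unfolding case_prod_unfold out_def
    proof (rule computable_fold2[OF add, where m = 2])
      show "computable_env (e ` S \<times> UNIV) (\<lambda>q. [fst q, snd q]) (\<lambda>q. list_encode (p (fst q)))"
        by (rule computable_env_comp1[OF comp_p]) (auto intro: computable_env_proj[of _ 0])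
      show "set (p (fst q)) \<subseteq> e ` S" if "q \<in> e ` S \<times> UNIV" for q :: "nat \<times> nat"
        using that p l closed by fastforce
    qed (auto intro: computable_env_proj[of _ 1])
  qed (auto intro: computable_env_0 computable_env_proj[of _ 0])
  have "computable_env {(x, k :: nat). x \<in> S} (\<lambda>(x, k). [k, e x]) (\<lambda>q. F (fst q) (snd q))"
    unfolding F_def
  proof (rule computable_env_rec[where m = 2], goal_cases)
    case 2
    show ?case unfolding out_def
    proof (rule computable_fold2[OF add, where m = 2])
      \<comment> \<open>This number is the code of the one-element list
        \<open>[e (fst q)]\<close>.\<close>
      have "computable_env {(x, k :: nat). x \<in> S} (\<lambda>(x, k). [k, e x])
          (\<lambda>q. Suc (prod_encode (e (fst q), 0)))"
        by (intro computable_env_Suc computable_prod_encode computable_env_0 computable_env_proj[of _ 1])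
          auto
      then show "computable_env {(x, k :: nat). x \<in> S} (\<lambda>(x, k). [k, e x]) (\<lambda>q. list_encode [e (fst q)])"
        by simp
    qed (auto intro: computable_env_0)
  next
    case 3
    show ?case unfolding F_def[symmetric] case_prod_unfold
    proof (rule computable_env_comp1[OF step_comp], goal_cases)
      case (2 q)
      then have x: "fst (fst q) \<in> S" by auto
      \<comment> \<open>\<open>step\<close> is known to be computable only on lists of codes of
        states in \<open>S\<close>; the invariant \<open>F\<close> shows that the recursion never
        leaves this domain.\<close>
      have "frontier P B (fst (fst q)) (snd q) \<subseteq> S" using closed x by (rule frontier_subset)
      then show ?case using F[OF x, of "snd q"] by (auto intro!: imageI)
    qed (auto intro: computable_env_proj[of _ 1])
  qed (auto intro: computable_env_proj[of _ 0])
  then have "computable_env S (\<lambda>x. [e x]) (\<lambda>x. LEAST k. F x k = 0)"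
  proof (intro computable_env_Least, goal_cases)
    case (2 x)
    then show ?case using F[OF 2(2)] ex[OF 2(2)] by (metis list_encode_eq_0 map_is_Nil_conv set_empty)
  qed (simp add: case_prod_unfold)
  moreover have "F x k = 0 \<longleftrightarrow> frontier P B x k = {}" if "x \<in> S" for x k
    using F[OF that, of k] by (auto simp: list_encode_eq_0)
  ultimately show ?thesis
    unfolding computable_on_eq by (elim computable_env_cong) (simp add: depth_def)
qed

theorem mainTheorem1:
  fixes \<L> :: signature
    and \<P> :: "inference set"
    and nf :: "fm \<Rightarrow> inference"
    and S B :: "fm set"
    and enc :: "fm \<Rightarrow> bool list"
    and P :: "fm \<Rightarrow> fm set"
  assumes "signature_wf \<L>"
    and "effective_proof_system \<L> \<P>"
    and "state_space \<L> S enc"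
    and "\<And>s. s \<in> S \<Longrightarrow> P s \<subseteq> S"
    and "B \<subseteq> S" and "finite B"
    and "decidable_on S (state_code enc) (\<lambda>s. s \<in> B)"
    and "\<And>s. s \<in> S \<Longrightarrow> finite (P s)"
    and "computable_predecessors S enc P"
    and "well_founded_unfolding S P"
    and "aligned \<P> nf S B P"
  shows "\<exists>Dd :: fm \<Rightarrow> nat.
           is_derivation_depth S P B (\<lambda>s. enat (Dd s)) \<and>
           (\<forall>Dd'. is_derivation_depth S P B Dd' \<longrightarrow> (\<forall>s\<in>S. Dd' s = enat (Dd s))) \<and>
           computable_on S (state_code enc) Dd"
proof -
  obtain l where l: "\<And>s. s \<in> S \<Longrightarrow> set (l s) = P s"
    and pred: "computable_on S (state_code enc) (\<lambda>s. list_encode (map (state_code enc) (l s)))"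
    using assms(9) unfolding computable_predecessors_def by blast
  have wf: "wf {(t, s). s \<in> S \<and> t \<in> P s}"
    using assms(10,4) by (rule well_founded_unfolding_wf)
  have ex: "\<exists>k. frontier P B s k = {}" if "s \<in> S" for s
    using wf assms(4,8) that by (rule frontier_eventually_empty)
  \<comment> \<open>This solution is finite, so uniqueness among all \<open>enat\<close>-valued
    candidates also excludes \<infinity> as a depth.\<close>
  have depth: "is_derivation_depth S P B (\<lambda>s. enat (depth P B s))"
    using assms(4,8) ex by (rule is_derivation_depth_depth)
  moreover have "computable_on S (state_code enc) (depth P B)"
    using pred l assms(7,4) ex by (rule computable_depth)
  ultimately show ?thesis
    using is_derivation_depth_unique[OF wf assms(4) depth] by blast
qed

end
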